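(* For all real numbers $x,y$, one has $D_{0}^{(s)}(x,y)=0$, and for every integer $n\ge 1$, $$D_{n}^{(s)}(x,y)=\sum_{j=1}^{n}\sum_{m=0}^{[\frac{j-1}{2}]}\binom{j}{2m+1}\binom{n}{j}(-1)^{m}x^{j-2m-1}y^{2m+1}D_{n-j}.$$
   Context: The sine-derangement polynomials $D_n^{(s)}(x,y)$, $n\ge 0$, are defined by the generating function (power series in $t$) $\displaystyle\frac{e^{-t}}{1-t}e^{xt}\sin(yt)=\sum_{n=0}^{\infty}D_{n}^{(s)}(x,y)\frac{t^{n}}{n!}$. $D_n$ denotes the derangement number, i.e. the number of fixed-point-free permutations of an $n$-element set ($D_0=1$); equivalently $D_n=n!\sum_{k=0}^n\frac{(-1)^k}{k!}$, with $\sum_{n\ge 0}D_n\frac{t^n}{n!}=\frac{e^{-t}}{1-t}$. $[a]$ denotes the greatest integer not exceeding $a$. Convention: $0^0=1$. *)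

theory Defs
  imports Complex_Main
    "HOL-Combinatorics.Permutations"
    "HOL-Computational_Algebra.Formal_Power_Series"
begin

definition derangement_number :: "nat \<Rightarrow> nat" where
  "derangement_number n = card {p. p permutes {..<n} \<and> (\<forall>i<n. p i \<noteq> i)}"

(* exp(-t) / (1 - t) * exp(x t) * sin(y t) as a formal power series in t:
   fps_exp c and fps_sin c are the series of exp(c t) and sin(c t). *)
definition sine_derangement_gf :: "real \<Rightarrow> real \<Rightarrow> real fps" where
  "sine_derangement_gf x y = fps_exp (- 1) / (1 - fps_X) * fps_exp x * fps_sin y"

definition sine_derangement :: "nat \<Rightarrow> real \<Rightarrow> real \<Rightarrow> real" where
  "sine_derangement n x y = fact n * fps_nth (sine_derangement_gf x y) n"

(* The defining identity of the generating function. *)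
lemma sine_derangement_gf_eq:
  "sine_derangement_gf x y = Abs_fps (\<lambda>n. sine_derangement n x y / fact n)"
  by (simp add: fps_eq_iff sine_derangement_def)

end

theory Submission
  imports Defs
begin

text \<open>
  The generating function is a product of two factors whose coefficients can be read off separately,
  and the formula is their binomial convolution.

  The first factor \<open>exp (-t) / (1 - t)\<close> is the exponential generating function of the derangement
  numbers (\<open>fps_derangement_number\<close>). With derangement numbers defined as a count of permutations,
  this is a combinatorial fact: a permutation of \<open>A\<close> is determined by the set of points it moves
  together with a derangement of that set, so \<open>n! = (\<Sum>k\<le>n. (n choose k) * D\<^sub>k)\<close>
  (\<open>fact_eq_sum_derangement_number\<close>). In terms of series, this says that \<open>exp t\<close> times the
  derangement series is \<open>1 + t + t\<^sup>2 + \<dots> = 1 / (1 - t)\<close>.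

  The second factor \<open>exp (x t) * sin (y t)\<close> is the imaginary part of \<open>exp ((x + i y) t)\<close>, so its
  \<open>j\<close>-th coefficient is \<open>1 / j!\<close> times the imaginary part of \<open>(x + i y)\<^sup>j\<close>, which explains the
  odd powers of \<open>y\<close> and the alternating signs. Over the reals the same sum arises by multiplying
  the two series (\<open>fps_exp_times_fps_sin_nth\<close>). It vanishes for \<open>j = 0\<close>, and therefore the outer sum starts at
  \<open>j = 1\<close>.
\<close>

text \<open>Only the size of the underlying set matters, because conjugation with a bijection
  preserves fixed-point-freeness.\<close>

lemma card_derangements:
  assumes "finite S"
  shows "card {p. p permutes S \<and> (\<forall>x\<in>S. p x \<noteq> x)} = derangement_number (card S)"
proof -
  obtain f where "bij_betw f {..<card S} S"
    using ex_bij_betw_nat_finite[OF assms] by (auto simp: atLeast0LessThan)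
  from bij_betw_same_card[OF bij_betw_derangements[OF this]]
  show ?thesis by (simp add: derangement_number_def Ball_def)
qed

text \<open>Sorting the permutations of \<open>A\<close> by the set \<open>S\<close> of points that they move partitions them into
  the derangements of the subsets of \<open>A\<close>: since a permutation of \<open>S\<close> is the identity
  outside \<open>S\<close>, no restriction or extension of maps is needed.\<close>

lemma permutations_eq_UN_derangements:
  "{p. p permutes A} = (\<Union>S\<in>Pow A. {p. p permutes S \<and> (\<forall>x\<in>S. p x \<noteq> x)})"
proof (intro equalityI subsetI)
  fix p assume "p \<in> {p. p permutes A}"
  then have p: "p permutes A" by simp
  have "p permutes {x \<in> A. p x \<noteq> x}"
    by (rule permutes_superset[OF p]) auto
  then show "p \<in> (\<Union>S\<in>Pow A. {p. p permutes S \<and> (\<forall>x\<in>S. p x \<noteq> x)})"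
    by (intro UN_I[of "{x \<in> A. p x \<noteq> x}"]) auto
qed (auto intro: permutes_subset)

lemma fact_eq_sum_derangement_number:
  "fact n = (\<Sum>k\<le>n. (n choose k) * derangement_number k)"
proof -
  define der :: "nat set \<Rightarrow> (nat \<Rightarrow> nat) set"
    where "der S = {p. p permutes S \<and> (\<forall>x\<in>S. p x \<noteq> x)}" for S
  let ?A = "{..<n}"
  \<comment> \<open>A member of \<open>der S\<close> moves exactly the points of \<open>S\<close>, and so determines \<open>S\<close>.\<close>
  have support: "S = {x. p x \<noteq> x}" if "p \<in> der S" for p S
    using that by (auto simp: der_def permutes_def)
  have "fact n = card {p. p permutes ?A}"
    by (simp add: card_permutations)
  also have "\<dots> = card (\<Union>S\<in>Pow ?A. der S)"
    by (simp add: permutations_eq_UN_derangements der_def)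
  also have "\<dots> = (\<Sum>S\<in>Pow ?A. card (der S))"
  proof (rule card_UN_disjoint)
    show "\<forall>S\<in>Pow ?A. finite (der S)"
      by (auto simp: der_def intro!: finite_subset[OF _ finite_permutations] dest: finite_subset)
    show "\<forall>S\<in>Pow ?A. \<forall>T\<in>Pow ?A. S \<noteq> T \<longrightarrow> der S \<inter> der T = {}"
      using support by blast
  qed simp
  also have "\<dots> = (\<Sum>S\<in>Pow ?A. derangement_number (card S))"
    by (intro sum.cong) (auto simp: der_def intro!: card_derangements dest: finite_subset)
  also have "\<dots> = (\<Sum>k\<le>n. card {S \<in> Pow ?A. card S = k} * derangement_number k)"
  proof -
    have "card ` Pow ?A \<subseteq> {..n}"
      using card_mono[of ?A] by fastforce
    from sum_fun_comp[OF _ _ this, of derangement_number] show ?thesis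
      by simp
  qed
  also have "\<dots> = (\<Sum>k\<le>n. (n choose k) * derangement_number k)"
    by (simp add: n_subsets)
  finally show ?thesis .
qed

lemma fps_derangement_number:
  "Abs_fps (\<lambda>n. real (derangement_number n) / fact n) = fps_exp (- 1) / (1 - fps_X)"
proof -
  let ?D = "Abs_fps (\<lambda>n. real (derangement_number n) / fact n)"
  have "?D * fps_exp 1 = Abs_fps (\<lambda>n. 1)"
  proof (rule fps_ext)
    fix n
    have "real (fact n) = (\<Sum>k\<le>n. real (n choose k) * real (derangement_number k))"
      unfolding fact_eq_sum_derangement_number by simp
    also have "\<dots> = fact n * fps_nth (?D * fps_exp 1) n"
      unfolding fps_mult_nth sum_distrib_left atLeast0AtMost
      by (intro sum.cong) (auto simp: binomial_fact)
    finally show "fps_nth (?D * fps_exp 1) n = fps_nth (Abs_fps (\<lambda>n. 1)) n" by simp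
  qed
  also have "\<dots> = inverse (1 - fps_X :: real fps)"
    by (metis fps_inverse_gp' fps_inverse_idempotent fps_nth_Abs_fps zero_neq_one)
  finally have "?D * fps_exp 1 * fps_exp (- 1) = fps_exp (- 1) * inverse (1 - fps_X)"
    by simp
  moreover have "fps_exp 1 * fps_exp (- 1) = (1 :: real fps)"
    by (simp flip: fps_exp_add_mult)
  ultimately show ?thesis
    by (simp add: fps_divide_unit mult.assoc)
qed

text \<open>Only odd powers of \<open>y\<close> occur in the sine series, so the convolution index runs over the odd
  numbers \<open>2 * m + 1 \<le> j\<close>. For \<open>j = 0\<close> there are none, although \<open>(j - 1) div 2\<close> is \<open>0\<close> for
  natural numbers; the formula survives because \<open>0 choose 1 = 0\<close>.\<close>

lemma fps_exp_times_fps_sin_nth: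
  fixes x y :: real
  shows "fact j * fps_nth (fps_exp x * fps_sin y) j =
    (\<Sum>m = 0..(j - 1) div 2.
       real (j choose (2 * m + 1)) * (- 1) ^ m * x ^ (j - 2 * m - 1) * y ^ (2 * m + 1))"
proof (cases "j = 0")
  case True
  then show ?thesis by (simp add: fps_sin_def)
next
  case False
  let ?g = "\<lambda>i. fact j * (fps_nth (fps_sin y) i * fps_nth (fps_exp x) (j - i))"
  have "fact j * fps_nth (fps_exp x * fps_sin y) j = (\<Sum>i = 0..j. ?g i)"
    by (simp add: mult.commute[of "fps_exp x"] fps_mult_nth sum_distrib_left)
  also have "\<dots> = (\<Sum>i | i \<le> j \<and> odd i. ?g i)"
    by (rule sum.mono_neutral_right) (auto simp: fps_sin_def)
  also have "\<dots> = (\<Sum>m = 0..(j - 1) div 2. ?g (2 * m + 1))"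
    using False
    by (intro sum.reindex_bij_witness[of _ "\<lambda>m. 2 * m + 1" "\<lambda>i. i div 2"]) (auto elim!: oddE)
  also have "\<dots> = (\<Sum>m = 0..(j - 1) div 2.
       real (j choose (2 * m + 1)) * (- 1) ^ m * x ^ (j - 2 * m - 1) * y ^ (2 * m + 1))"
  proof (rule sum.cong)
    fix m assume "m \<in> {0..(j - 1) div 2}"
    with False have "2 * m + 1 \<le> j" by auto
    then show "?g (2 * m + 1) =
      real (j choose (2 * m + 1)) * (- 1) ^ m * x ^ (j - 2 * m - 1) * y ^ (2 * m + 1)"
      by (simp add: fps_sin_def binomial_fact mult_ac del: fact_Suc)
  qed simp
  finally show ?thesis .
qed

theorem theorem13:
  fixes x y :: real
  shows "sine_derangement 0 x y = 0 \<and>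
    (\<forall>n::nat. n \<ge> 1 \<longrightarrow>
      sine_derangement n x y =
        (\<Sum>j = 1..n. \<Sum>m = 0..(j - 1) div 2.
           real (j choose (2 * m + 1)) * real (n choose j) * (- 1) ^ m *
           x ^ (j - 2 * m - 1) * y ^ (2 * m + 1) * real (derangement_number (n - j))))"
proof (intro conjI allI impI)
  show "sine_derangement 0 x y = 0"
    by (simp add: sine_derangement_def sine_derangement_gf_def fps_sin_def)
next
  fix n :: nat
  define a where "a j = fps_nth (fps_exp x * fps_sin y) j" for j
  have a0: "a 0 = 0"
    by (simp add: a_def fps_sin_def)
  have "sine_derangement_gf x y =
      fps_exp x * fps_sin y * Abs_fps (\<lambda>n. real (derangement_number n) / fact n)"
    unfolding sine_derangement_gf_def fps_derangement_number by (simp only: ac_simps)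
  then have "sine_derangement n x y =
      (\<Sum>j = 0..n. fact n * (a j * (derangement_number (n - j) / fact (n - j))))"
    by (simp add: sine_derangement_def fps_mult_nth[of "fps_exp x * fps_sin y"] a_def
        sum_distrib_left)
  also have "\<dots> = (\<Sum>j = 1..n. fact n * (a j * (derangement_number (n - j) / fact (n - j))))"
    by (simp add: sum.atLeast_Suc_atMost a0)
  also have "\<dots> = (\<Sum>j = 1..n. real (n choose j) * derangement_number (n - j) * (fact j * a j))"
    by (intro sum.cong) (auto simp: binomial_fact)
  also have "\<dots> = (\<Sum>j = 1..n. \<Sum>m = 0..(j - 1) div 2.
           real (j choose (2 * m + 1)) * real (n choose j) * (- 1) ^ m *
           x ^ (j - 2 * m - 1) * y ^ (2 * m + 1) * real (derangement_number (n - j)))"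
    unfolding a_def fps_exp_times_fps_sin_nth sum_distrib_left
    by (intro sum.cong refl) (simp only: ac_simps)
  finally show "sine_derangement n x y = (\<Sum>j = 1..n. \<Sum>m = 0..(j - 1) div 2.
           real (j choose (2 * m + 1)) * real (n choose j) * (- 1) ^ m *
           x ^ (j - 2 * m - 1) * y ^ (2 * m + 1) * real (derangement_number (n - j)))" .
qed

end
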